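(* Let $p$ be a prime and let $G=\bigoplus_{i=1}^s G_i$ be a bounded abelian $p$-group with $G_i\cong(\mathbb Z_{p^{n_i}})^{r_i}$, $0<n_1<\cdots<n_s$. Let $\mathcal J$ be the Jacobson radical of $\mathcal E=\operatorname{End}(G)$ with upper annihilating sequence $\{\mathcal J_t\}$ of annihilating length $d$. Then for $1\le t\le d$, in the matrix representation of $\mathcal E$, $$\mathcal J_t=\{A=(A_{ij})\in\mathcal J:\ A_{ij}\equiv 0 \pmod{p^{n_j-\alpha(i,j,t)}}\text{ for all }1\le i,j\le s\},$$ where the function $\alpha$ on $\{1,\dots,s\}\times\{1,\dots,s\}\times\{1,\dots,d\}$ is defined recursively in $t$ by: (1) $\alpha(s,s,1)=1$ and $\alpha(i,j,1)=0$ for $(i,j)\ne(s,s)$; (2) for $t\ge2$, $$\alpha(i,j,t)=\min\{\,n_j-n_{j-1}+\alpha(i,j-1,t-1),\ n_i-n_{i-1}+\alpha(i-1,j,t-1),\ \alpha(i,j,t-1)+1,\ \alpha(i+1,j,t-1),\ \alpha(i,j+1,t-1)\,\},$$ where terms involving an index outside $\{1,\dots,s\}$ are omitted.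
   Context: An endomorphism of $G$ is identified with a matrix $A=(A_{ij})_{s\times s}$, $A_{ij}\in\mathcal E_{ij}=\operatorname{Hom}(G_i,G_j)$, where $f(x)=\sum_j f_{ij}(x)$ for $x\in G_i$; products are $(AB)_{ij}=\sum_k A_{ik}B_{kj}$. With respect to fixed bases, $A_{ij}$ is an $r_i\times r_j$ (row-finite) matrix with entries in $\mathbb Z_{p^{n_j}}$, with all entries divisible by $p^{n_j-n_i}$ if $i<j$. $A_{ij}\equiv0\pmod{p^m}$ means all entries are divisible by $p^m$ (vacuous if $m\le0$). $\mathcal J$ consists of the $A\in\mathcal E$ with $A_{ii}\in p\,\mathcal E_{ii}$ for all $i$. Upper annihilating sequence: $\mathcal J_0=0$, $\mathcal J_t=\{a\in\mathcal J: a\mathcal J\subseteq\mathcal J_{t-1},\ \mathcal J a\subseteq\mathcal J_{t-1}\}$ for $t\ge1$; the annihilating length is the least $d$ with $\mathcal J_d=\mathcal J$. *)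

theory Defs
  imports "HOL-Algebra.Algebra" "HOL-Computational_Algebra.Primes"
begin

definition left_ideal :: "'a set \<Rightarrow> ('a, 'b) ring_scheme \<Rightarrow> bool" where
  "left_ideal I R \<longleftrightarrow> additive_subgroup I R \<and> (\<forall>x\<in>carrier R. \<forall>a\<in>I. x \<otimes>\<^bsub>R\<^esub> a \<in> I)"

definition maximal_left_ideal :: "'a set \<Rightarrow> ('a, 'b) ring_scheme \<Rightarrow> bool" where
  "maximal_left_ideal I R \<longleftrightarrow> left_ideal I R \<and> I \<noteq> carrier R \<and>
     (\<forall>K. left_ideal K R \<and> I \<subseteq> K \<longrightarrow> K = I \<or> K = carrier R)"

definition jacobson_radical :: "('a, 'b) ring_scheme \<Rightarrow> 'a set" where
  "jacobson_radical R = carrier R \<inter> \<Inter> {I. maximal_left_ideal I R}"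

primrec upper_ann :: "('a, 'b) ring_scheme \<Rightarrow> 'a set \<Rightarrow> nat \<Rightarrow> 'a set" where
  "upper_ann R J 0 = {\<zero>\<^bsub>R\<^esub>}"
| "upper_ann R J (Suc t) =
     {a \<in> J. \<forall>b\<in>J. a \<otimes>\<^bsub>R\<^esub> b \<in> upper_ann R J t \<and> b \<otimes>\<^bsub>R\<^esub> a \<in> upper_ann R J t}"

definition ann_length :: "('a, 'b) ring_scheme \<Rightarrow> 'a set \<Rightarrow> nat" where
  "ann_length R J = (LEAST d. upper_ann R J d = J)"

text \<open>
  Abelian groups are written multiplicatively, so addition of endomorphisms is pointwise
  group multiplication. The ring product \<open>f g\<close> applies \<open>f\<close> first: this is the order for which
  the matrix of a product satisfies \<open>(AB)\<^sub>i\<^sub>j = \<Sum>\<^sub>k A\<^sub>i\<^sub>k B\<^sub>k\<^sub>j\<close> with \<open>A\<^sub>i\<^sub>k \<in> Hom(G\<^sub>i, G\<^sub>k)\<close>.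
\<close>

definition End_ring :: "('a, 'b) monoid_scheme \<Rightarrow> ('a \<Rightarrow> 'a) ring" where
  "End_ring G =
     \<lparr>carrier = hom G G \<inter> extensional (carrier G),
      monoid.mult = (\<lambda>f g. compose (carrier G) g f),
      one = (\<lambda>x\<in>carrier G. x),
      ring.zero = (\<lambda>x\<in>carrier G. \<one>\<^bsub>G\<^esub>),
      ring.add = (\<lambda>f g. \<lambda>x\<in>carrier G. f x \<otimes>\<^bsub>G\<^esub> g x)\<rparr>"

lemma ring_End_ring:
  assumes "comm_group G"
  shows "ring (End_ring G)"
proof -
  interpret comm_group G by (rule assms)
  show ?thesis
  proof (intro ringI abelian_groupI monoidI)
    fix f assume f: "f \<in> carrier (End_ring G)"
    define g where "g = (\<lambda>x\<in>carrier G. inv\<^bsub>G\<^esub> (f x))"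
    have "g \<in> carrier (End_ring G)"
      using f by (auto simp: End_ring_def hom_def Pi_def g_def inv_mult)
    moreover have "g \<oplus>\<^bsub>End_ring G\<^esub> f = \<zero>\<^bsub>End_ring G\<^esub>"
      using f by (auto simp: End_ring_def hom_def Pi_def g_def fun_eq_iff)
    ultimately show "\<exists>g\<in>carrier (End_ring G). g \<oplus>\<^bsub>End_ring G\<^esub> f = \<zero>\<^bsub>End_ring G\<^esub>"
      by blast
  qed (auto simp: End_ring_def hom_def Pi_def compose_def fun_eq_iff extensional_def m_ac)
qed

definition subgrp :: "('a, 'b) monoid_scheme \<Rightarrow> 'a set \<Rightarrow> ('a, 'b) monoid_scheme" where
  "subgrp G H = G\<lparr>carrier := H\<rparr>"

text \<open>\<open>G\<close> is the internal direct sum of the finite family of subgroups \<open>(H i)\<close>, \<open>i \<in> I\<close>.\<close>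

definition internal_direct_sum ::
    "('a, 'b) monoid_scheme \<Rightarrow> 'i set \<Rightarrow> ('i \<Rightarrow> 'a set) \<Rightarrow> bool" where
  "internal_direct_sum G I H \<longleftrightarrow>
     finite I \<and> (\<forall>i\<in>I. subgroup (H i) G) \<and>
     (\<lambda>x. finprod G x I) \<in> iso (sum_group I (\<lambda>i. subgrp G (H i))) G"

definition component ::
    "('a, 'b) monoid_scheme \<Rightarrow> 'i set \<Rightarrow> ('i \<Rightarrow> 'a set) \<Rightarrow> 'i \<Rightarrow> 'a \<Rightarrow> 'a" where
  "component G I H j g =
     inv_into (carrier (sum_group I (\<lambda>i. subgrp G (H i)))) (\<lambda>x. finprod G x I) g j"

definition block ::
    "('a, 'b) monoid_scheme \<Rightarrow> 'i set \<Rightarrow> ('i \<Rightarrow> 'a set) \<Rightarrow> ('a \<Rightarrow> 'a) \<Rightarrow> 'i \<Rightarrow> 'i \<Rightarrow> 'a \<Rightarrow> 'a" where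
  "block G I H f i j = (\<lambda>x\<in>H i. component G I H j (f x))"

text \<open>The direct sum of \<open>|B|\<close> copies of \<open>\<int>/m\<close>; \<open>B\<close> may be infinite.\<close>

definition Zmod_sum :: "nat \<Rightarrow> 'k set \<Rightarrow> ('k \<Rightarrow> int) monoid" where
  "Zmod_sum m B = sum_group B (\<lambda>_. integer_mod_group m)"

text \<open>
  A basis of \<open>H\<close> over \<open>\<int>/m\<close> indexed by \<open>B\<close> is given by a coordinate isomorphism
  \<open>\<phi>\<close> from \<open>H\<close> to \<open>Zmod_sum m B\<close>; its elements are the preimages of the unit vectors.
\<close>

definition basis_elem :: "'a set \<Rightarrow> 'k set \<Rightarrow> ('a \<Rightarrow> 'k \<Rightarrow> int) \<Rightarrow> 'k \<Rightarrow> 'a" where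
  "basis_elem H B \<phi> k = inv_into H \<phi> (\<lambda>l\<in>B. if l = k then 1 else 0)"

text \<open>
  Row \<open>k\<close> of the matrix of \<open>h : G\<^sub>i \<rightarrow> G\<^sub>j\<close> lists the coordinates of the image of the \<open>k\<close>-th basis
  element of \<open>G\<^sub>i\<close>. Entries are the representatives in \<open>{0..<p^n\<^sub>j}\<close> of elements of \<open>\<int>/p^n\<^sub>j\<close>.
\<close>

definition mat_entry ::
    "'a set \<Rightarrow> 'k set \<Rightarrow> ('a \<Rightarrow> 'k \<Rightarrow> int) \<Rightarrow> ('a \<Rightarrow> 'k \<Rightarrow> int) \<Rightarrow> ('a \<Rightarrow> 'a) \<Rightarrow> 'k \<Rightarrow> 'k \<Rightarrow> int" where
  "mat_entry Hi Bi \<phi>i \<phi>j h k l = \<phi>j (h (basis_elem Hi Bi \<phi>i k)) l"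

text \<open>Only values with \<open>i, j \<in> {1..s}\<close> and \<open>t \<ge> 1\<close> are meaningful.\<close>

fun alpha :: "(nat \<Rightarrow> nat) \<Rightarrow> nat \<Rightarrow> nat \<Rightarrow> nat \<Rightarrow> nat \<Rightarrow> nat" where
  "alpha n s i j 0 = 0"
| "alpha n s i j (Suc 0) = (if i = s \<and> j = s then 1 else 0)"
| "alpha n s i j (Suc (Suc t)) = Min (
       (if 1 < j then {n j - n (j - 1) + alpha n s i (j - 1) (Suc t)} else {}) \<union>
       (if 1 < i then {n i - n (i - 1) + alpha n s (i - 1) j (Suc t)} else {}) \<union>
       {alpha n s i j (Suc t) + 1} \<union>
       (if i < s then {alpha n s (i + 1) j (Suc t)} else {}) \<union>
       (if j < s then {alpha n s i (j + 1) (Suc t)} else {}))"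

end

theory Submission
  imports Defs
begin

text \<open>
  Call \<open>e\<^sub>u\<close> the basis elements of all summands, \<open>c\<^sub>u\<close> their coordinate functions, and let \<open>u\<close>
  belong to the block \<open>b u\<close>. An endomorphism \<open>f\<close> is then the matrix of the \<open>c\<^sub>v (f e\<^sub>u)\<close>.

  The Jacobson radical consists of the \<open>f\<close> whose diagonal blocks vanish modulo \<open>p\<close>: these form an
  ideal of nilpotent elements, and an \<open>f\<close> with an entry \<open>(u, v)\<close> of a diagonal block not
  divisible by \<open>p\<close> lies outside the maximal left ideal of the endomorphisms whose column \<open>v\<close>
  vanishes modulo \<open>p\<close> on the block of \<open>v\<close>.

  Since \<open>\<alpha>(i, j, 0) = 0\<close> describes the zero ideal and the recursion for \<open>\<alpha>\<close> also yields \<open>t = 1\<close> from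
  \<open>t = 0\<close>, a single induction on \<open>t\<close> suffices. Multiplication by elementary endomorphisms between
  neighbouring blocks forces the bounds of the recursion. Conversely, for a product with an arbitrary
  element of the radical all pairs of blocks matter; these reduce to neighbouring ones because \<open>\<alpha>\<close> is
  monotone in \<open>i\<close> and \<open>j\<close> and grows from \<open>j\<close> to \<open>k\<close> by at most \<open>n\<^sub>k - n\<^sub>j\<close>.
\<close>

section \<open>The function alpha\<close>

text \<open>For positive \<open>t\<close> each bound is a term of the minimum. For
  \<open>t = 0\<close> the left side is at most 1 and vanishes off \<open>(s, s)\<close>, so the
  positive gaps of \<open>n\<close> or the exclusion of \<open>(s, s)\<close> give the
  bounds.\<close>

lemma alpha_Suc_le:
  fixes n :: "nat \<Rightarrow> nat"
  assumes "strict_mono_on {1..s} n" "i \<in> {1..s}" "j \<in> {1..s}"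
  shows "alpha n s i j (Suc t) \<le> alpha n s i j t + 1"
    and "1 < j \<Longrightarrow> alpha n s i j (Suc t) \<le> n j - n (j - 1) + alpha n s i (j - 1) t"
    and "1 < i \<Longrightarrow> alpha n s i j (Suc t) \<le> n i - n (i - 1) + alpha n s (i - 1) j t"
    and "j < s \<Longrightarrow> alpha n s i j (Suc t) \<le> alpha n s i (j + 1) t"
    and "i < s \<Longrightarrow> alpha n s i j (Suc t) \<le> alpha n s (i + 1) j t"
proof -
  have gap: "0 < n k - n (k - 1)" if "k \<in> {1..s}" "1 < k" for k
  proof -
    have "k - 1 \<in> {1..s}" using that by auto
    then show ?thesis using strict_mono_onD[OF assms(1), of "k - 1" k] that by auto
  qed
  show "alpha n s i j (Suc t) \<le> alpha n s i j t + 1"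
  proof (cases t)
    case (Suc t')
    show ?thesis
      unfolding Suc alpha.simps by (rule Min_le) auto
  qed auto
  show "alpha n s i j (Suc t) \<le> n j - n (j - 1) + alpha n s i (j - 1) t" if "1 < j"
  proof (cases t)
    case (Suc t')
    show ?thesis
      unfolding Suc alpha.simps by (rule Min_le) (use that in auto)
  qed (use that gap[OF assms(3)] in auto)
  show "alpha n s i j (Suc t) \<le> n i - n (i - 1) + alpha n s (i - 1) j t" if "1 < i"
  proof (cases t)
    case (Suc t')
    show ?thesis
      unfolding Suc alpha.simps by (rule Min_le) (use that in auto)
  qed (use that gap[OF assms(2)] in auto)
  show "alpha n s i j (Suc t) \<le> alpha n s i (j + 1) t" if "j < s"
  proof (cases t)
    case (Suc t')
    show ?thesis
      unfolding Suc alpha.simps by (rule Min_le) (use that in auto)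
  qed (use that in auto)
  show "alpha n s i j (Suc t) \<le> alpha n s (i + 1) j t" if "i < s"
  proof (cases t)
    case (Suc t')
    show ?thesis
      unfolding Suc alpha.simps by (rule Min_le) (use that in auto)
  qed (use that in auto)
qed

text \<open>The minimum is attained. For \<open>t = 0\<close> the pair \<open>(s, s)\<close> falls
  under \<open>same\<close>, and every other pair under \<open>right\<close> or \<open>down\<close>
  with both sides 0.\<close>

lemma alpha_Suc_cases:
  fixes n :: "nat \<Rightarrow> nat"
  assumes "i \<in> {1..s}" "j \<in> {1..s}"
  obtains (same) "alpha n s i j (Suc t) = alpha n s i j t + 1"
    | (left) "1 < j" "alpha n s i j (Suc t) = n j - n (j - 1) + alpha n s i (j - 1) t"
    | (up) "1 < i" "alpha n s i j (Suc t) = n i - n (i - 1) + alpha n s (i - 1) j t"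
    | (right) "j < s" "alpha n s i j (Suc t) = alpha n s i (j + 1) t"
    | (down) "i < s" "alpha n s i j (Suc t) = alpha n s (i + 1) j t"
proof (cases t)
  case 0
  then show ?thesis
    using assms that(1,4,5) by (cases "j < s"; cases "i < s") auto
next
  case (Suc t')
  let ?S = "(if 1 < j then {n j - n (j - 1) + alpha n s i (j - 1) t} else {}) \<union>
       (if 1 < i then {n i - n (i - 1) + alpha n s (i - 1) j t} else {}) \<union>
       {alpha n s i j t + 1} \<union>
       (if i < s then {alpha n s (i + 1) j t} else {}) \<union>
       (if j < s then {alpha n s i (j + 1) t} else {})"
  have "alpha n s i j (Suc t) = Min ?S"
    by (simp only: Suc alpha.simps)
  moreover have "Min ?S \<in> ?S"
    by (intro Min_in) auto
  ultimately have "alpha n s i j (Suc t) \<in> ?S"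
    by (simp only:)
  then show ?thesis
    using that by (auto split: if_splits)
qed

text \<open>Exchanging the indices only permutes the terms of the minimum. This later carries the
  bounds for right multiplication over to left multiplication.\<close>

lemma alpha_commute: "alpha n s i j t = alpha n s j i t"
proof (induction t arbitrary: i j)
  case (Suc t)
  show ?case
  proof (cases t)
    case (Suc t')
    then show ?thesis
      unfolding Suc alpha.simps using Suc.IH[unfolded Suc]
      by (intro arg_cong[where f = Min]) auto
  qed simp
qed simp

text \<open>For each inequality, take the term that attains the minimum on the right-hand side,
  bound the left-hand side by its corresponding term, and compare the two by the induction
  hypothesis.\<close>

lemma alpha_step:
  fixes n :: "nat \<Rightarrow> nat"
  assumes n: "strict_mono_on {1..s} n" and "i \<in> {1..s}" "1 \<le> j" "j < s"
  shows "alpha n s i j t \<le> alpha n s i (Suc j) t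
    \<and> alpha n s i (Suc j) t \<le> n (Suc j) - n j + alpha n s i j t"
  using assms(2-)
proof (induction t arbitrary: i j)
  case (Suc t)
  have gap: "n k < n (Suc k)" if "1 \<le> k" "k < s" for k
    using strict_mono_onD[OF n, of k "Suc k"] that by auto
  have j: "j \<in> {1..s}" "Suc j \<in> {1..s}" and i: "i \<in> {1..s}" using Suc.prems by auto
  note le = alpha_Suc_le[OF n i j(1), of t]
  note le' = alpha_Suc_le[OF n i j(2), of t]
  have "alpha n s i j (Suc t) \<le> alpha n s i (Suc j) (Suc t)"
    using i j(2)
  proof (cases rule: alpha_Suc_cases[where n = n and t = t])
    case same
    then show ?thesis using le Suc.IH[of i j] Suc.prems by auto
  next
    \<comment> \<open>The attained term already refers to \<open>alpha n s i j t\<close>. As the gap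
      is at least 1, the bound with \<open>+ 1\<close> is enough.\<close>
    case left
    then show ?thesis using le(1) gap[of j] Suc.prems by auto
  next
    case up
    then have "i - 1 \<in> {1..s}" using i by auto
    with up show ?thesis using le(3) Suc.IH[of "i - 1" j] Suc.prems by auto
  next
    case right
    then show ?thesis using le(4) Suc.IH[of i "Suc j"] Suc.prems by auto
  next
    case down
    then show ?thesis using le(5) Suc.IH[of "i + 1" j] Suc.prems by auto
  qed
  moreover have "alpha n s i (Suc j) (Suc t) \<le> n (Suc j) - n j + alpha n s i j (Suc t)"
    using i j(1)
  proof (cases rule: alpha_Suc_cases[where n = n and t = t])
    case same
    then show ?thesis using le'(1) Suc.IH[of i j] Suc.prems by auto
  next
    case left
    then have "1 \<le> j - 1" "j - 1 < s" using Suc.prems by auto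
    with left show ?thesis using le'(2) Suc.IH[of i "j - 1"] Suc.prems by auto
  next
    case up
    then have "i - 1 \<in> {1..s}" using i by auto
    with up show ?thesis using le'(3) Suc.IH[of "i - 1" j] Suc.prems by auto
  next
    \<comment> \<open>Again the attained term refers to the other position itself, and the gap
      absorbs the \<open>+ 1\<close>.\<close>
    case right
    then show ?thesis using le'(1) gap[of j] Suc.prems by auto
  next
    case down
    then show ?thesis using le'(5) Suc.IH[of "i + 1" j] Suc.prems by auto
  qed
  ultimately show ?case by simp
qed simp

lemma alpha_mono_lipschitz:
  fixes n :: "nat \<Rightarrow> nat"
  assumes n: "strict_mono_on {1..s} n" and "i \<in> {1..s}" "1 \<le> j" "j \<le> k" "k \<le> s"
  shows "alpha n s i j t \<le> alpha n s i k t \<and> alpha n s i k t \<le> n k - n j + alpha n s i j t"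
  using assms(4,5)
proof (induction k rule: dec_induct)
  case (step k)
  \<comment> \<open>Subtraction of naturals is truncated; the differences telescope because
    \<open>n\<close> increases.\<close>
  have "n j \<le> n k" "n k \<le> n (Suc k)"
    using strict_mono_on_leD[OF n] step assms(3) by auto
  then show ?case
    using step alpha_step[OF n assms(2), of k t] assms(3) by auto
qed simp

text \<open>In a matrix product the middle index \<open>k\<close> may be far from \<open>j\<close>.
  One step of the recursion moves \<open>k\<close> to its neighbour towards \<open>j\<close>, and
  \<open>alpha_mono_lipschitz\<close> covers the remaining distance.\<close>

lemma alpha_Suc_bounds:
  fixes n :: "nat \<Rightarrow> nat"
  assumes n: "strict_mono_on {1..s} n" and ijk: "i \<in> {1..s}" "j \<in> {1..s}" "k \<in> {1..s}"
  shows "k < j \<Longrightarrow> alpha n s i k (Suc t) \<le> alpha n s i j t"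
    and "j < k \<Longrightarrow> alpha n s i k (Suc t) \<le> n k - n j + alpha n s i j t"
proof -
  show "alpha n s i k (Suc t) \<le> alpha n s i j t" if "k < j"
    using alpha_Suc_le(4)[OF n ijk(1,3), of t] alpha_mono_lipschitz[OF n ijk(1), of "k + 1" j t]
      ijk that by auto
  show "alpha n s i k (Suc t) \<le> n k - n j + alpha n s i j t" if "j < k"
  proof -
    have "n j \<le> n (k - 1)" "n (k - 1) \<le> n k"
      using strict_mono_on_leD[OF n] ijk that by auto
    moreover have "alpha n s i (k - 1) t \<le> n (k - 1) - n j + alpha n s i j t"
      using alpha_mono_lipschitz[OF n ijk(1), of j "k - 1" t] ijk that by simp
    moreover have "alpha n s i k (Suc t) \<le> n k - n (k - 1) + alpha n s i (k - 1) t"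
      using alpha_Suc_le(2)[OF n ijk(1,3), of t] ijk that by simp
    ultimately show ?thesis by linarith
  qed
qed

section \<open>Endomorphisms in coordinates\<close>

text \<open>The bases of all summands are merged into one index set \<open>U\<close>, possibly
  infinite, and \<open>b\<close> remembers the blocks. Together \<open>c_finite\<close> and
  \<open>c_inj\<close> say that every element is a finite combination of the
  \<open>e u\<close>.\<close>

locale adapted_basis = comm_group G for G (structure) +
  fixes p s :: nat and n :: "nat \<Rightarrow> nat" and U :: "'u set" and b :: "'u \<Rightarrow> nat"
    and e :: "'u \<Rightarrow> 'a" and c :: "'u \<Rightarrow> 'a \<Rightarrow> int"
  assumes prime: "normalization_semidom_class.prime p"
    and n_pos: "i \<in> {1..s} \<Longrightarrow> 0 < n i"
    and n_mono: "strict_mono_on {1..s} n"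
    and b_image: "b ` U = {1..s}"
    and e_closed: "u \<in> U \<Longrightarrow> e u \<in> carrier G"
    and e_pow: "u \<in> U \<Longrightarrow> e u [^] (p ^ n (b u)) = \<one>"
    and c_hom: "u \<in> U \<Longrightarrow> c u \<in> hom G (integer_mod_group (p ^ n (b u)))"
    and c_e: "u \<in> U \<Longrightarrow> v \<in> U \<Longrightarrow> c v (e u) = of_bool (u = v)"
    and c_finite: "x \<in> carrier G \<Longrightarrow> finite {u \<in> U. c u x \<noteq> 0}"
    and c_inj: "x \<in> carrier G \<Longrightarrow> (\<And>u. u \<in> U \<Longrightarrow> c u x = 0) \<Longrightarrow> x = \<one>"
begin

abbreviation E :: "('a \<Rightarrow> 'a) ring" where
  "E \<equiv> End_ring G"

abbreviation order_exp :: "'u \<Rightarrow> nat" where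
  "order_exp u \<equiv> n (b u)"

definition entry :: "('a \<Rightarrow> 'a) \<Rightarrow> 'u \<Rightarrow> 'u \<Rightarrow> int" where
  "entry f u v = c v (f (e u))"

sublocale E: ring E
  by (rule ring_End_ring) (rule comm_group_axioms)

lemma p_gt_1: "1 < int p"
  using prime prime_gt_1_nat by auto

lemma prime_int_p: "normalization_semidom_class.prime (int p)"
  using prime by simp

lemma b_in: "u \<in> U \<Longrightarrow> b u \<in> {1..s}"
  using b_image by blast

lemma order_exp_less_iff: "u \<in> U \<Longrightarrow> v \<in> U \<Longrightarrow> order_exp u < order_exp v \<longleftrightarrow> b u < b v"
  using strict_mono_on_less[OF n_mono b_in b_in] by simp

lemma order_exp_pos: "u \<in> U \<Longrightarrow> 0 < order_exp u"
  using n_pos b_in by blast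

section \<open>Endomorphisms and coordinate functions under the group operations\<close>

lemma carrier_E_iff: "f \<in> carrier E \<longleftrightarrow> f \<in> hom G G \<and> f \<in> extensional (carrier G)"
  by (simp add: End_ring_def)

lemma E_closed: "f \<in> carrier E \<Longrightarrow> x \<in> carrier G \<Longrightarrow> f x \<in> carrier G"
  by (auto simp: carrier_E_iff hom_def)

lemma E_mult: "f \<in> carrier E \<Longrightarrow> x \<in> carrier G \<Longrightarrow> y \<in> carrier G \<Longrightarrow> f (x \<otimes> y) = f x \<otimes> f y"
  by (auto simp: carrier_E_iff hom_def)

lemma E_int_pow: "f \<in> carrier E \<Longrightarrow> x \<in> carrier G \<Longrightarrow> f (x [^] (k :: int)) = f x [^] k"
  using hom_int_pow[of f G G x k] is_group by (simp add: carrier_E_iff)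

lemma E_eqI:
  assumes "f \<in> carrier E" "g \<in> carrier E" "\<And>x. x \<in> carrier G \<Longrightarrow> f x = g x"
  shows "f = g"
  using assms by (auto simp: carrier_E_iff intro: extensionalityI)

lemma mult_apply: "x \<in> carrier G \<Longrightarrow> (f \<otimes>\<^bsub>E\<^esub> g) x = g (f x)"
  by (simp add: End_ring_def compose_eq)

lemma add_apply: "x \<in> carrier G \<Longrightarrow> (f \<oplus>\<^bsub>E\<^esub> g) x = f x \<otimes> g x"
  by (simp add: End_ring_def)

lemma one_apply: "x \<in> carrier G \<Longrightarrow> \<one>\<^bsub>E\<^esub> x = x"
  by (simp add: End_ring_def)

lemma zero_apply: "x \<in> carrier G \<Longrightarrow> \<zero>\<^bsub>E\<^esub> x = \<one>"
  by (simp add: End_ring_def)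

lemma c_range: "u \<in> U \<Longrightarrow> x \<in> carrier G \<Longrightarrow> 0 \<le> c u x \<and> c u x < int p ^ order_exp u"
  using c_hom[of u] p_gt_1 by (auto simp: hom_def carrier_integer_mod_group Pi_iff)

lemma c_eq_0_iff: "u \<in> U \<Longrightarrow> x \<in> carrier G \<Longrightarrow> c u x = 0 \<longleftrightarrow> int p ^ order_exp u dvd c u x"
  using c_range[of u x] by (auto simp: dvd_eq_mod_eq_0)

lemma c_int_pow:
  assumes "u \<in> U" "x \<in> carrier G"
  shows "c u (x [^] (k :: int)) = k * c u x mod int p ^ order_exp u"
  using hom_int_pow[OF c_hom[OF assms(1)] assms(2) is_group] group_integer_mod_group assms
  by (simp add: int_pow_integer_mod_group)

lemma c_mult:
  assumes "u \<in> U" "x \<in> carrier G" "y \<in> carrier G"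
  shows "c u (x \<otimes> y) = (c u x + c u y) mod int p ^ order_exp u"
  using hom_mult[OF c_hom[OF assms(1)] assms(2,3)] by simp

lemma dvd_c_mult_iff:
  assumes "u \<in> U" "x \<in> carrier G" "y \<in> carrier G" "k \<le> order_exp u"
  shows "int p ^ k dvd c u (x \<otimes> y) \<longleftrightarrow> int p ^ k dvd c u x + c u y"
  using assms by (simp add: c_mult dvd_mod_iff le_imp_power_dvd)

lemma dvd_c_int_pow_iff:
  assumes "u \<in> U" "x \<in> carrier G" "k \<le> order_exp u"
  shows "int p ^ k dvd c u (x [^] (m :: int)) \<longleftrightarrow> int p ^ k dvd m * c u x"
  using assms by (simp add: c_int_pow dvd_mod_iff le_imp_power_dvd)

lemma c_one: "u \<in> U \<Longrightarrow> c u \<one> = 0"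
  using c_int_pow[of u \<one> 0] by simp

text \<open>An endomorphism is determined row by row; this is multiplication of a vector by a matrix,
  stated only up to divisibility so that no infinite sum has to be written down.\<close>

lemma dvd_c_apply:
  assumes f: "f \<in> carrier E" and x: "x \<in> carrier G" and v: "v \<in> U" and k: "k \<le> order_exp v"
    and dvd: "\<And>u. u \<in> U \<Longrightarrow> int p ^ k dvd c u x * entry f u v"
  shows "int p ^ k dvd c v (f x)"
proof -
  \<comment> \<open>Induction on a finite set containing the support of \<open>x\<close>, removing
    one coordinate at a time.\<close>
  have "int p ^ k dvd c v (f x)"
    if "finite A" "A \<subseteq> U" "x \<in> carrier G" "{u \<in> U. c u x \<noteq> 0} \<subseteq> A"
      "\<And>u. u \<in> A \<Longrightarrow> int p ^ k dvd c u x * entry f u v" for A x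
    using that
  proof (induction A arbitrary: x)
    case empty
    then have "x = \<one>" by (intro c_inj) auto
    moreover have "f \<one> = \<one>"
      using E_int_pow[OF f, of \<one> 0] by simp
    ultimately show ?case using c_one v by simp
  next
    case (insert u A)
    note u = \<open>insert u A \<subseteq> U\<close>
    \<comment> \<open>\<open>y\<close> is the part of \<open>x\<close> along \<open>e u\<close>. The
      rest \<open>z\<close> has the coordinates of \<open>x\<close>, except for 0 at
      \<open>u\<close>.\<close>
    define y where "y = e u [^] c u x"
    define z where "z = x \<otimes> inv y"
    have uU: "u \<in> U" and eu: "e u \<in> carrier G" and y: "y \<in> carrier G" and z: "z \<in> carrier G"
      using u insert.prems e_closed by (auto simp: y_def z_def)
    have cz: "c w z = (c w x - c u x * of_bool (u = w)) mod int p ^ order_exp w" if "w \<in> U" for w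
    proof -
      have "inv y = e u [^] (- c u x)"
        using eu by (simp add: y_def int_pow_neg)
      then have "c w z = (c w x + (- c u x * of_bool (u = w)) mod int p ^ order_exp w) mod int p ^ order_exp w"
        using that insert.prems(2) eu c_e[OF uU that] y
        by (simp add: z_def c_mult c_int_pow)
      then show ?thesis by (simp add: mod_simps)
    qed
    have cz': "c w z = (if w = u then 0 else c w x)" if "w \<in> U" for w
      using cz[OF that] c_range[OF that insert.prems(2)] by auto
    have "int p ^ k dvd c v (f z)"
    proof (rule insert.IH)
      show "{u \<in> U. c u z \<noteq> 0} \<subseteq> A"
        using insert.prems(3) cz' by (auto split: if_splits)
      show "int p ^ k dvd c u z * entry f u v" if "u \<in> A" for u
        using that insert.prems(1,4) cz'[of u] by auto
    qed (use insert.prems z in auto)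
    moreover have "int p ^ k dvd c v (f y)"
      using insert.prems(4)[of u] eu v k f E_closed[OF f eu]
      by (simp add: y_def E_int_pow dvd_c_int_pow_iff entry_def)
    moreover have "f x = f z \<otimes> f y"
      using insert.prems(2) y z E_mult[OF f z y] by (simp add: z_def m_assoc)
    ultimately show ?case
      using E_closed[OF f y] E_closed[OF f z] v k by (simp add: dvd_c_mult_iff)
  qed
  from this[OF c_finite[OF x] _ x] show ?thesis using dvd by blast
qed

text \<open>Row \<open>u\<close> of \<open>f\<close> is the coordinate vector of
  \<open>f (e u)\<close>, so this is \<open>dvd_c_apply\<close> for that vector.\<close>

lemma dvd_entry_mult:
  assumes f: "f \<in> carrier E" and "g \<in> carrier E" and u: "u \<in> U" and "v \<in> U" "k \<le> order_exp v"
    and "\<And>w. w \<in> U \<Longrightarrow> int p ^ k dvd entry f u w * entry g w v"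
  shows "int p ^ k dvd entry (f \<otimes>\<^bsub>E\<^esub> g) u v"
  using dvd_c_apply[of g "f (e u)" v k] assms e_closed[OF u] E_closed[OF f]
  by (simp add: entry_def mult_apply)

section \<open>Matrix entries and the ring structure\<close>

lemma entry_add:
  assumes "u \<in> U" "v \<in> U" "f \<in> carrier E" "g \<in> carrier E"
  shows "entry (f \<oplus>\<^bsub>E\<^esub> g) u v = (entry f u v + entry g u v) mod int p ^ order_exp v"
  using assms e_closed by (simp add: entry_def add_apply c_mult E_closed)

lemma entry_zero: "u \<in> U \<Longrightarrow> v \<in> U \<Longrightarrow> entry \<zero>\<^bsub>E\<^esub> u v = 0"
  by (simp add: entry_def zero_apply e_closed c_one)

lemma entry_one: "u \<in> U \<Longrightarrow> v \<in> U \<Longrightarrow> entry \<one>\<^bsub>E\<^esub> u v = of_bool (u = v)"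
  by (simp add: entry_def one_apply e_closed c_e)

lemma entry_uminus:
  assumes "u \<in> U" "v \<in> U" "f \<in> carrier E"
  shows "entry (\<ominus>\<^bsub>E\<^esub> f) u v = - entry f u v mod int p ^ order_exp v"
proof -
  have "0 = (entry (\<ominus>\<^bsub>E\<^esub> f) u v + entry f u v) mod int p ^ order_exp v"
    using entry_add[of u v "\<ominus>\<^bsub>E\<^esub> f" f] assms by (simp add: E.l_neg entry_zero)
  then have "entry (\<ominus>\<^bsub>E\<^esub> f) u v mod int p ^ order_exp v = - entry f u v mod int p ^ order_exp v"
    by (metis diff_0 add_diff_cancel_right' mod_diff_left_eq)
  moreover have "entry (\<ominus>\<^bsub>E\<^esub> f) u v mod int p ^ order_exp v = entry (\<ominus>\<^bsub>E\<^esub> f) u v"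
    using c_range[OF assms(2) E_closed[OF E.a_inv_closed[OF assms(3)] e_closed[OF assms(1)]]]
    by (simp add: entry_def)
  ultimately show ?thesis by simp
qed

lemma eq_zero_iff:
  assumes "f \<in> carrier E"
  shows "f = \<zero>\<^bsub>E\<^esub> \<longleftrightarrow> (\<forall>u\<in>U. \<forall>v\<in>U. int p ^ order_exp v dvd entry f u v)"
proof
  assume *: "\<forall>u\<in>U. \<forall>v\<in>U. int p ^ order_exp v dvd entry f u v"
  show "f = \<zero>\<^bsub>E\<^esub>"
  proof (rule E_eqI)
    fix x assume x: "x \<in> carrier G"
    have "f x = \<one>"
      using x assms * dvd_c_apply[OF assms x] by (intro c_inj) (auto simp: c_eq_0_iff E_closed)
    then show "f x = \<zero>\<^bsub>E\<^esub> x" using x by (simp add: zero_apply)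
  qed (use assms in auto)
qed (simp add: entry_def zero_apply e_closed c_one)

text \<open>The power \<open>p ^ order_exp u\<close> kills \<open>e u\<close>, hence also its image
  under \<open>f\<close>; thus this power times the entry vanishes modulo
  \<open>p ^ order_exp v\<close>.\<close>

lemma order_diff_dvd_entry:
  assumes f: "f \<in> carrier E" and u: "u \<in> U" and v: "v \<in> U"
  shows "int p ^ (order_exp v - order_exp u) dvd entry f u v"
proof (cases "order_exp u \<le> order_exp v")
  case True
  have "f (e u) [^] (int p ^ order_exp u) = f (e u [^] (int p ^ order_exp u))"
    using E_int_pow[OF f e_closed[OF u]] by simp
  also have "\<dots> = f (\<one> [^] (0::int))"
    using e_pow[OF u] int_pow_int[of G "e u" "p ^ order_exp u"] by simp
  also have "\<dots> = \<one>"
    using E_int_pow[OF f, of \<one> 0] by simp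
  finally have "int p ^ order_exp v dvd int p ^ order_exp u * entry f u v"
    using dvd_c_int_pow_iff[of v "f (e u)" "order_exp v" "int p ^ order_exp u"] v u f e_closed c_one
    by (simp add: entry_def E_closed)
  then have "int p ^ order_exp u * int p ^ (order_exp v - order_exp u) dvd int p ^ order_exp u * entry f u v"
    using True by (simp flip: power_add)
  then show ?thesis using p_gt_1 by simp
qed simp

section \<open>Elementary endomorphisms: multiples of matrix units\<close>

definition elementary :: "'u \<Rightarrow> 'u \<Rightarrow> nat \<Rightarrow> 'a \<Rightarrow> 'a" where
  "elementary u v m = (\<lambda>x\<in>carrier G. e v [^] (int m * c u x))"

lemma e_int_pow_cong:
  assumes "u \<in> U" "int p ^ order_exp u dvd k - l"
  shows "e u [^] (k :: int) = e u [^] l"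
proof -
  obtain r where r: "k = l + int p ^ order_exp u * r"
    using assms(2) by (metis dvdE diff_add_cancel add.commute)
  have "e u [^] (int p ^ order_exp u * r) = (e u [^] (p ^ order_exp u)) [^] r"
    using assms(1) e_closed int_pow_int[of G "e u" "p ^ order_exp u"]
    by (simp add: int_pow_pow[symmetric])
  then show ?thesis
    using assms(1) e_closed e_pow by (simp add: r int_pow_mult)
qed

text \<open>On representatives \<open>c u\<close> is additive only modulo
  \<open>p ^ order_exp u\<close>. The condition on \<open>m\<close> turns this error into a multiple
  of \<open>p ^ order_exp v\<close>, which kills \<open>e v\<close>.\<close>

lemma elementary_closed:
  assumes u: "u \<in> U" and v: "v \<in> U" and m: "p ^ (order_exp v - order_exp u) dvd m"
  shows "elementary u v m \<in> carrier E"
proof -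
  have "e v [^] (int m * c u (x \<otimes> y)) = e v [^] (int m * c u x) \<otimes> e v [^] (int m * c u y)"
    if "x \<in> carrier G" "y \<in> carrier G" for x y
  proof -
    have "int p ^ order_exp u dvd c u (x \<otimes> y) - (c u x + c u y)"
      using c_mult[OF u that] by (metis mod_eq_dvd_iff mod_mod_trivial)
    moreover have "int p ^ (order_exp v - order_exp u) dvd int m"
      using m by (metis of_nat_dvd_iff of_nat_power)
    ultimately have "int p ^ (order_exp v - order_exp u) * int p ^ order_exp u
        dvd int m * (c u (x \<otimes> y) - (c u x + c u y))"
      by (rule mult_dvd_mono[rotated])
    moreover have "int p ^ order_exp v dvd int p ^ (order_exp v - order_exp u) * int p ^ order_exp u"
      by (simp add: le_imp_power_dvd flip: power_add)
    ultimately have "int p ^ order_exp v dvd int m * c u (x \<otimes> y) - (int m * c u x + int m * c u y)"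
      by (auto simp: algebra_simps intro: dvd_trans)
    then show ?thesis
      using e_int_pow_cong[OF v] e_closed[OF v] by (simp add: int_pow_mult)
  qed
  then show ?thesis
    using e_closed[OF v] by (auto simp: carrier_E_iff elementary_def hom_def)
qed

lemma entry_elementary:
  assumes "u \<in> U" "v \<in> U" "u' \<in> U" "v' \<in> U"
  shows "entry (elementary u v m) u' v' = of_bool (u = u' \<and> v = v') * int m mod int p ^ order_exp v"
  using assms e_closed c_e by (auto simp: entry_def elementary_def c_int_pow)

lemma entry_mult_elementary:
  assumes "f \<in> carrier E" "u \<in> U" "v \<in> U" "w \<in> U"
  shows "entry (f \<otimes>\<^bsub>E\<^esub> elementary v w m) u w = int m * entry f u v mod int p ^ order_exp w"
  using assms e_closed c_e[of w w]
  by (simp add: entry_def mult_apply elementary_def c_int_pow E_closed)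

lemma entry_elementary_mult:
  assumes "f \<in> carrier E" "u \<in> U" "v \<in> U" "w \<in> U" "w' \<in> U"
  shows "entry (elementary w u m \<otimes>\<^bsub>E\<^esub> f) w' v
    = of_bool (w = w') * int m * entry f u v mod int p ^ order_exp v"
  using assms e_closed c_e[of w' w]
  by (simp add: entry_def mult_apply elementary_def E_int_pow c_int_pow E_closed)

section \<open>The Jacobson radical\<close>

text \<open>A description by entries, identified with the Jacobson radical in
  \<open>jacobson_radical_eq\<close>.\<close>

definition radical :: "('a \<Rightarrow> 'a) set" where
  "radical = {f \<in> carrier E. \<forall>u\<in>U. \<forall>v\<in>U. b u = b v \<longrightarrow> int p dvd entry f u v}"

lemma radicalD: "f \<in> radical \<Longrightarrow> u \<in> U \<Longrightarrow> v \<in> U \<Longrightarrow> b u = b v \<Longrightarrow> int p dvd entry f u v"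
  by (simp add: radical_def)

lemma radical_closed: "f \<in> radical \<Longrightarrow> f \<in> carrier E"
  by (simp add: radical_def)

section \<open>Matrices modulo p\<close>

lemma p_dvd_entry_of_less:
  assumes "f \<in> carrier E" "u \<in> U" "v \<in> U" "b u < b v"
  shows "int p dvd entry f u v"
proof -
  have "order_exp u < order_exp v"
    using assms order_exp_less_iff by simp
  then have "int p ^ 1 dvd int p ^ (order_exp v - order_exp u)"
    by (intro le_imp_power_dvd) simp
  then show ?thesis
    using order_diff_dvd_entry[OF assms(1-3)] dvd_trans by simp
qed

text \<open>Modulo \<open>p\<close> matrices are block lower triangular, so diagonal blocks multiply
  separately. One row of \<open>f\<close> or one column of \<open>g\<close> suffices, which serves
  both the ideal property of \<open>radical\<close> and the left ideals given by a column.\<close>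

lemma p_dvd_entry_mult:
  assumes "f \<in> carrier E" "g \<in> carrier E" "u \<in> U" "v \<in> U" "b u = b v"
    and "(\<forall>w\<in>U. b w = b u \<longrightarrow> int p dvd entry f u w) \<or> (\<forall>w\<in>U. b w = b u \<longrightarrow> int p dvd entry g w v)"
  shows "int p dvd entry (f \<otimes>\<^bsub>E\<^esub> g) u v"
proof -
  have "int p ^ 1 dvd entry f u w * entry g w v" if w: "w \<in> U" for w
  proof (cases "b w" "b u" rule: linorder_cases)
    case less
    then have "int p dvd entry g w v"
      using p_dvd_entry_of_less[OF assms(2) w assms(4)] assms(5) by simp
    then show ?thesis by simp
  next
    case equal
    then show ?thesis using assms(6) w by auto
  next
    case greater
    then have "int p dvd entry f u w"
      using p_dvd_entry_of_less[OF assms(1,3) w] by simp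
    then show ?thesis by simp
  qed
  then show ?thesis
    using dvd_entry_mult[OF assms(1-4), of 1] order_exp_pos[OF assms(4)] by simp
qed

lemma radical_mult_right:
  assumes "f \<in> radical" "g \<in> carrier E"
  shows "f \<otimes>\<^bsub>E\<^esub> g \<in> radical"
  using p_dvd_entry_mult[of f g] assms by (auto simp: radical_def)

lemma radical_mult_left:
  assumes "f \<in> carrier E" "g \<in> radical"
  shows "f \<otimes>\<^bsub>E\<^esub> g \<in> radical"
  using p_dvd_entry_mult[of f g] assms by (auto simp: radical_def)

lemma elementary_in_radical:
  assumes "u \<in> U" "v \<in> U" "p ^ (order_exp v - order_exp u) dvd m" "b u = b v \<Longrightarrow> p dvd m"
  shows "elementary u v m \<in> radical"
proof -
  have "int p dvd int p ^ order_exp v"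
    using order_exp_pos[OF assms(2)] by simp
  then show ?thesis
    using assms elementary_closed[OF assms(1-3)]
    by (auto simp: radical_def entry_elementary dvd_mod_iff)
qed

text \<open>Giving \<open>p\<^sup>a e\<^sub>u\<close> the weight \<open>2 a - n\<^sub>u\<close>, every element of the radical raises weights:
  by \<open>2\<close> within a block, and by the difference of the exponents between two blocks.
  Below, weights are shifted by \<open>n\<^sub>s\<close>, so that they range over the natural numbers.\<close>

lemma radical_nilpotent:
  assumes f: "f \<in> radical"
  shows "f [^]\<^bsub>E\<^esub> (2 * n s) = \<zero>\<^bsub>E\<^esub>"
proof -
  have fE: "f \<in> carrier E" using f by (rule radical_closed)
  have n_le: "order_exp v \<le> n s" if "v \<in> U" for v
    using strict_mono_on_leD[OF n_mono] b_in[OF that] by auto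
  \<comment> \<open>\<open>y\<close> and \<open>x\<close> are the exponents of the blocks before and
    after one more factor, whose entry supplies the last summand. Since the weight grows by at least
    1, the bound survives rounding.\<close>
  have weight_step: "min x ((Suc m + x + 1 - N) div 2)
      \<le> min y ((m + y + 1 - N) div 2) + (if y = x then 1 else x - y)" for x m N y :: nat
  proof -
    define d where "d = (if y = x then 1 else x - y)"
    have "(Suc m + x + 1 - N) div 2 \<le> (m + y + 1 - N + d * 2) div 2"
      by (intro div_le_mono) (auto simp: d_def)
    then have "(Suc m + x + 1 - N) div 2 \<le> (m + y + 1 - N) div 2 + d"
      by simp
    moreover have "x \<le> y + d" by (auto simp: d_def)
    ultimately show ?thesis unfolding d_def[symmetric] by linarith
  qed
  \<comment> \<open>After \<open>m\<close> factors the shifted weight is at least \<open>m\<close>.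
    Solving for the exponent of \<open>p\<close> and rounding up gives \<open>a m v\<close>, capped
    at \<open>order_exp v\<close>, where the entry vanishes.\<close>
  define a where "a m v = min (order_exp v) ((m + order_exp v + 1 - n s) div 2)" for m v
  have pow: "int p ^ a m v dvd entry (f [^]\<^bsub>E\<^esub> m) u v" if u: "u \<in> U" and v: "v \<in> U" for m u v
    using v
  proof (induction m arbitrary: v)
    case 0
    then have "a 0 v = 0" using n_le[of v] by (simp add: a_def)
    then show ?case by simp
  next
    case (Suc m)
    have "int p ^ a (Suc m) v dvd entry (f [^]\<^bsub>E\<^esub> m) u w * entry f w v" if w: "w \<in> U" for w
    proof -
      define d where "d = (if b w = b v then 1 else order_exp v - order_exp w)"
      have "int p ^ d dvd entry f w v"
        using radicalD[OF f w Suc.prems] order_diff_dvd_entry[OF fE w Suc.prems]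
        by (simp add: d_def)
      moreover have "a (Suc m) v \<le> a m w + d"
      proof -
        have "b w = b v \<longleftrightarrow> order_exp w = order_exp v"
          using order_exp_less_iff[OF w Suc.prems] order_exp_less_iff[OF Suc.prems w]
          by (metis linorder_neqE_nat less_irrefl)
        then show ?thesis
          unfolding a_def d_def using weight_step[of "order_exp v" m "n s" "order_exp w"] by simp
      qed
      ultimately have "int p ^ (a m w + d) dvd entry (f [^]\<^bsub>E\<^esub> m) u w * entry f w v"
        using Suc.IH[OF w] by (simp add: power_add mult_dvd_mono)
      then show ?thesis
        using le_imp_power_dvd[OF \<open>a (Suc m) v \<le> a m w + d\<close>] dvd_trans by blast
    qed
    then show ?case
      using dvd_entry_mult[of "f [^]\<^bsub>E\<^esub> m" f u v "a (Suc m) v"] fE u Suc.prems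
      by (simp add: a_def)
  qed
  \<comment> \<open>The cap is reached because \<open>n s + order_exp v\<close> is at least twice
    \<open>order_exp v\<close>.\<close>
  have "a (2 * n s) v = order_exp v" if "v \<in> U" for v
  proof -
    have "order_exp v \<le> (2 * n s + order_exp v + 1 - n s) div 2"
      using n_le[OF that] by linarith
    then show ?thesis by (simp add: a_def)
  qed
  then have "int p ^ order_exp v dvd entry (f [^]\<^bsub>E\<^esub> (2 * n s)) u v"
    if "u \<in> U" "v \<in> U" for u v
    using pow[of u v "2 * n s"] that by simp
  then show ?thesis
    using fE by (simp add: eq_zero_iff)
qed

text \<open>If \<open>f\<close> lay outside \<open>M\<close>, the left ideal \<open>K\<close>
  generated by \<open>M\<close> and \<open>f\<close> would be everything, so 1 is the sum of some
  \<open>m\<close> in \<open>M\<close> and a multiple \<open>h\<close> of \<open>f\<close>.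
  Multiplying by powers of the nilpotent \<open>h\<close> leads from 0 in \<open>M\<close> down to 1
  in \<open>M\<close>.\<close>

lemma radical_le_maximal_left_ideal:
  assumes M: "maximal_left_ideal M E"
  shows "radical \<subseteq> M"
proof
  fix f assume f: "f \<in> radical"
  then have fE: "f \<in> carrier E" by (rule radical_closed)
  from M have lM: "left_ideal M E" and M_ne: "M \<noteq> carrier E"
    and max: "\<And>K. left_ideal K E \<Longrightarrow> M \<subseteq> K \<Longrightarrow> K = M \<or> K = carrier E"
    by (auto simp: maximal_left_ideal_def)
  interpret M: additive_subgroup M E using lM by (simp add: left_ideal_def)
  have M_mult: "x \<otimes>\<^bsub>E\<^esub> a \<in> M" if "x \<in> carrier E" "a \<in> M" for x a
    using lM that by (simp add: left_ideal_def)
  show "f \<in> M"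
  proof (rule ccontr)
    assume "f \<notin> M"
    define K where "K = {m \<oplus>\<^bsub>E\<^esub> g \<otimes>\<^bsub>E\<^esub> f | m g. m \<in> M \<and> g \<in> carrier E}"
    have "left_ideal K E"
      unfolding left_ideal_def
    proof (intro conjI ballI)
      show "additive_subgroup K E"
      proof (intro additive_subgroup.intro E.add.subgroupI)
        show "K \<subseteq> carrier E" using fE by (auto simp: K_def)
        show "K \<noteq> {}" using M.zero_closed E.one_closed unfolding K_def by blast
        fix x assume "x \<in> K"
        then obtain m g where x: "x = m \<oplus>\<^bsub>E\<^esub> g \<otimes>\<^bsub>E\<^esub> f" and m: "m \<in> M" and g: "g \<in> carrier E"
          by (auto simp: K_def)
        have "\<ominus>\<^bsub>E\<^esub> x = \<ominus>\<^bsub>E\<^esub> m \<oplus>\<^bsub>E\<^esub> (\<ominus>\<^bsub>E\<^esub> g) \<otimes>\<^bsub>E\<^esub> f"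
          using x m g fE by (simp add: E.minus_add E.l_minus)
        then show "\<ominus>\<^bsub>E\<^esub> x \<in> K" using m g by (auto simp: K_def)
        fix y assume "y \<in> K"
        then obtain m' g' where y: "y = m' \<oplus>\<^bsub>E\<^esub> g' \<otimes>\<^bsub>E\<^esub> f" and m': "m' \<in> M" and g': "g' \<in> carrier E"
          by (auto simp: K_def)
        have "x \<oplus>\<^bsub>E\<^esub> y = (m \<oplus>\<^bsub>E\<^esub> m') \<oplus>\<^bsub>E\<^esub> (g \<oplus>\<^bsub>E\<^esub> g') \<otimes>\<^bsub>E\<^esub> f"
          using x y m m' g g' fE by (simp add: E.l_distr E.a_ac)
        then show "x \<oplus>\<^bsub>E\<^esub> y \<in> K" using m m' g g' by (auto simp: K_def)
      qed
    next
      fix x k assume x: "x \<in> carrier E" and "k \<in> K"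
      then obtain m g where k: "k = m \<oplus>\<^bsub>E\<^esub> g \<otimes>\<^bsub>E\<^esub> f" and m: "m \<in> M" and g: "g \<in> carrier E"
        by (auto simp: K_def)
      have "x \<otimes>\<^bsub>E\<^esub> k = x \<otimes>\<^bsub>E\<^esub> m \<oplus>\<^bsub>E\<^esub> (x \<otimes>\<^bsub>E\<^esub> g) \<otimes>\<^bsub>E\<^esub> f"
        using k x m g fE by (simp add: E.r_distr E.m_assoc)
      then show "x \<otimes>\<^bsub>E\<^esub> k \<in> K" using M_mult[OF x m] x g by (auto simp: K_def)
    qed
    moreover have "M \<subseteq> K"
    proof
      fix m assume m: "m \<in> M"
      then have "m = m \<oplus>\<^bsub>E\<^esub> \<zero>\<^bsub>E\<^esub> \<otimes>\<^bsub>E\<^esub> f" using fE by simp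
      then show "m \<in> K" using m by (auto simp: K_def)
    qed
    moreover have "f \<in> K"
    proof -
      have "f = \<zero>\<^bsub>E\<^esub> \<oplus>\<^bsub>E\<^esub> \<one>\<^bsub>E\<^esub> \<otimes>\<^bsub>E\<^esub> f" using fE by simp
      then show ?thesis by (force simp: K_def)
    qed
    ultimately have "\<one>\<^bsub>E\<^esub> \<in> K" using max[of K] \<open>f \<notin> M\<close> by auto
    then obtain m g where one: "\<one>\<^bsub>E\<^esub> = m \<oplus>\<^bsub>E\<^esub> g \<otimes>\<^bsub>E\<^esub> f" and m: "m \<in> M" and g: "g \<in> carrier E"
      by (auto simp: K_def)
    define h where "h = g \<otimes>\<^bsub>E\<^esub> f"
    have h: "h \<in> radical" and hE: "h \<in> carrier E"
      using radical_mult_left[OF g f] by (auto simp: h_def radical_closed)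
    have step: "h [^]\<^bsub>E\<^esub> k \<in> M" if "h [^]\<^bsub>E\<^esub> Suc k \<in> M" for k
    proof -
      have "h [^]\<^bsub>E\<^esub> k = h [^]\<^bsub>E\<^esub> k \<otimes>\<^bsub>E\<^esub> (m \<oplus>\<^bsub>E\<^esub> h)"
        using one hE by (simp add: h_def flip: one)
      also have "\<dots> = h [^]\<^bsub>E\<^esub> k \<otimes>\<^bsub>E\<^esub> m \<oplus>\<^bsub>E\<^esub> h [^]\<^bsub>E\<^esub> Suc k"
        using hE m by (simp add: E.r_distr)
      finally show ?thesis
        using that M_mult[OF _ m] hE by (metis E.nat_pow_closed M.a_closed)
    qed
    have "h [^]\<^bsub>E\<^esub> k \<in> M" if "k \<le> 2 * n s" for k
      using that
    proof (induction rule: inc_induct)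
      case base
      then show ?case by (simp add: radical_nilpotent[OF h])
    qed (rule step)
    from this[of 0] have "\<one>\<^bsub>E\<^esub> \<in> M" by simp
    then have "carrier E \<subseteq> M" using M_mult by (metis E.r_one subsetI)
    then show False using M_ne M.a_subset by blast
  qed
qed

text \<open>Modulo \<open>p\<close>, the column \<open>v\<close> of a diagonal block is a linear functional on an
  \<open>\<int>/p\<close>-vector space; the endomorphisms whose image it annihilates form a maximal left ideal.\<close>

lemma maximal_left_ideal_column:
  assumes v: "v \<in> U"
  shows "maximal_left_ideal {a \<in> carrier E. \<forall>u\<in>U. b u = b v \<longrightarrow> int p dvd entry a u v} E"
    (is "maximal_left_ideal ?M E")
proof -
  have p_dvd: "int p dvd int p ^ order_exp v" using order_exp_pos[OF v] by simp
  have left: "left_ideal ?M E"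
    unfolding left_ideal_def
  proof (intro conjI ballI)
    show "additive_subgroup ?M E"
    proof (intro additive_subgroup.intro E.add.subgroupI)
      have "\<zero>\<^bsub>E\<^esub> \<in> ?M" using v by (simp add: entry_zero)
      then show "?M \<noteq> {}" by blast
    qed (use v p_dvd in \<open>auto simp: entry_add entry_uminus dvd_mod_iff\<close>)
    show "x \<otimes>\<^bsub>E\<^esub> a \<in> ?M" if "x \<in> carrier E" "a \<in> ?M" for x a
      using that p_dvd_entry_mult[of x a] v by auto
  qed
  have "K = carrier E" if K: "left_ideal K E" and MK: "?M \<subseteq> K" and "K \<noteq> ?M" for K
  proof -
    interpret K: additive_subgroup K E using K by (simp add: left_ideal_def)
    have K_mult: "x \<otimes>\<^bsub>E\<^esub> a \<in> K" if "x \<in> carrier E" "a \<in> K" for x a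
      using K that by (simp add: left_ideal_def)
    obtain a where a: "a \<in> K" "a \<notin> ?M" using \<open>?M \<subseteq> K\<close> \<open>K \<noteq> ?M\<close> by blast
    then have aE: "a \<in> carrier E" by auto
    obtain u where u: "u \<in> U" "b u = b v" "\<not> int p dvd entry a u v"
      using a aE by auto
    have "coprime (entry a u v) (int p)"
      using prime_int_p u(3) by (metis coprime_commute prime_imp_coprime)
    then obtain y r where y: "y * entry a u v + r * int p = 1"
      using bezout_int[of "entry a u v" "int p"] by (auto simp: coprime_iff_gcd_eq_1)
    \<comment> \<open>A natural number inverse to \<open>entry a u v\<close> modulo
      \<open>p\<close>, since \<open>elementary\<close> takes a natural multiplier.\<close>
    define m where "m = nat (y mod int p)"
    have m: "int m = y mod int p" using p_gt_1 by (simp add: m_def)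
    have "int m * entry a u v mod int p = y * entry a u v mod int p"
      by (simp add: m mod_simps)
    also have "\<dots> = 1 mod int p"
      using y by (metis mod_mult_self1)
    finally have my: "int p dvd int m * entry a u v - 1"
      by (simp add: mod_eq_dvd_iff)
    \<comment> \<open>The only nonzero row of the product of \<open>x\<close> and \<open>a\<close>
      is row \<open>v\<close>, with entry 1 modulo \<open>p\<close> in column \<open>v\<close>.
      Subtracting it from the identity clears column \<open>v\<close> modulo
      \<open>p\<close>.\<close>
    define x where "x = elementary v u m"
    have xE: "x \<in> carrier E" using u v by (auto simp: x_def elementary_closed)
    have "\<one>\<^bsub>E\<^esub> \<oplus>\<^bsub>E\<^esub> \<ominus>\<^bsub>E\<^esub> (x \<otimes>\<^bsub>E\<^esub> a) \<in> ?M"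
    proof -
      have "int p dvd entry (\<one>\<^bsub>E\<^esub> \<oplus>\<^bsub>E\<^esub> \<ominus>\<^bsub>E\<^esub> (x \<otimes>\<^bsub>E\<^esub> a)) w v" if w: "w \<in> U" for w
      proof -
        have "int p dvd of_bool (w = v) - of_bool (v = w) * int m * entry a u v"
          using my by (simp add: dvd_diff_commute)
        then show ?thesis
          using w v u(1) xE aE p_dvd
          by (simp add: x_def entry_add entry_uminus entry_one entry_elementary_mult dvd_mod_iff mod_simps)
      qed
      then show ?thesis using xE aE by simp
    qed
    moreover have "x \<otimes>\<^bsub>E\<^esub> a \<in> K" using xE a K_mult by blast
    ultimately have "(\<one>\<^bsub>E\<^esub> \<oplus>\<^bsub>E\<^esub> \<ominus>\<^bsub>E\<^esub> (x \<otimes>\<^bsub>E\<^esub> a)) \<oplus>\<^bsub>E\<^esub> x \<otimes>\<^bsub>E\<^esub> a \<in> K"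
      using MK by blast
    then have "\<one>\<^bsub>E\<^esub> \<in> K" using xE aE by (simp add: E.a_assoc E.l_neg)
    then have "carrier E \<subseteq> K" using K_mult by (metis E.r_one subsetI)
    then show ?thesis using K.a_subset by blast
  qed
  moreover have "?M \<noteq> carrier E"
  proof
    assume "?M = carrier E"
    then have "\<one>\<^bsub>E\<^esub> \<in> ?M" by simp
    then have "int p dvd entry \<one>\<^bsub>E\<^esub> v v" using v by blast
    then show False using entry_one[OF v v] p_gt_1 by simp
  qed
  ultimately show ?thesis using left by (auto simp: maximal_left_ideal_def)
qed

lemma jacobson_radical_eq: "jacobson_radical E = radical"
proof
  show "radical \<subseteq> jacobson_radical E"
    using radical_le_maximal_left_ideal radical_closed by (auto simp: jacobson_radical_def)
  show "jacobson_radical E \<subseteq> radical"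
    using maximal_left_ideal_column by (fastforce simp: jacobson_radical_def radical_def)
qed

section \<open>The upper annihilating sequence\<close>

text \<open>The closed form in merged coordinates. Where \<open>alpha\<close> exceeds
  \<open>order_exp v\<close>, truncated subtraction makes the condition vacuous, as intended for a
  modulus with exponent at most 0.\<close>

definition level :: "nat \<Rightarrow> ('a \<Rightarrow> 'a) set" where
  "level t = {f \<in> radical. \<forall>u\<in>U. \<forall>v\<in>U.
     int p ^ (order_exp v - alpha n s (b u) (b v) t) dvd entry f u v}"

lemma level_0: "level 0 = {\<zero>\<^bsub>E\<^esub>}"
proof -
  have "f \<in> level 0 \<longleftrightarrow> f = \<zero>\<^bsub>E\<^esub>" for f
  proof
    assume "f \<in> level 0"
    then show "f = \<zero>\<^bsub>E\<^esub>"
      by (subst eq_zero_iff) (auto simp: level_def radical_closed)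
  next
    assume "f = \<zero>\<^bsub>E\<^esub>"
    then show "f \<in> level 0"
      by (simp add: level_def radical_def entry_zero)
  qed
  then show ?thesis by blast
qed

section \<open>The two inclusions between levels and annihilators\<close>

lemma dvd_mult_of_exponents:
  fixes x y :: int
  assumes "int p ^ i dvd x" "int p ^ j dvd y" "k \<le> i + j"
  shows "int p ^ k dvd x * y"
  using dvd_trans[OF le_imp_power_dvd[OF assms(3)]] mult_dvd_mono[OF assms(1,2)]
  by (simp add: power_add)

lemma dvd_cancel_power:
  fixes x :: int
  assumes "int p ^ k dvd int p ^ j * x"
  shows "int p ^ (k - j) dvd x"
proof (cases "j \<le> k")
  case True
  then have "int p ^ k = int p ^ j * int p ^ (k - j)"
    by (simp flip: power_add)
  then show ?thesis using assms p_gt_1 by simp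
qed simp

text \<open>In each summand the exponents of the two factors add up. The radical factor contributes
  1 within a block and the truncated difference of exponents otherwise;
  \<open>alpha_Suc_bounds\<close> and the \<open>+ 1\<close> term of the recursion show that the sum
  is large enough.\<close>

lemma level_mult:
  assumes "f \<in> level (Suc t)" and g: "g \<in> radical"
  shows "f \<otimes>\<^bsub>E\<^esub> g \<in> level t" and "g \<otimes>\<^bsub>E\<^esub> f \<in> level t"
proof -
  have f: "f \<in> radical" and fE: "f \<in> carrier E" and gE: "g \<in> carrier E"
    using assms by (auto simp: level_def radical_closed)
  have lev: "int p ^ (order_exp v - alpha n s (b u) (b v) (Suc t)) dvd entry f u v"
    if "u \<in> U" "v \<in> U" for u v
    using assms(1) that by (auto simp: level_def)
  have g_dvd: "int p ^ (if b u = b v then 1 else order_exp v - order_exp u) dvd entry g u v"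
    if "u \<in> U" "v \<in> U" for u v
    using that radicalD[OF g that] order_diff_dvd_entry[OF gE that] by simp
  have n_le: "n i \<le> n j" if "i \<in> {1..s}" "j \<in> {1..s}" "i \<le> j" for i j
    using strict_mono_on_leD[OF n_mono] that by blast
  have "int p ^ (order_exp v - alpha n s (b u) (b v) t) dvd entry (f \<otimes>\<^bsub>E\<^esub> g) u v"
    if u: "u \<in> U" and v: "v \<in> U" for u v
  proof (rule dvd_entry_mult[OF fE gE u v])
    fix w assume w: "w \<in> U"
    show "int p ^ (order_exp v - alpha n s (b u) (b v) t) dvd entry f u w * entry g w v"
    proof (rule dvd_mult_of_exponents[OF lev[OF u w] g_dvd[OF w v]])
      note bds = alpha_Suc_bounds[OF n_mono b_in[OF u] b_in[OF v] b_in[OF w], of t]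
        alpha_Suc_le(1)[OF n_mono b_in[OF u] b_in[OF v], of t]
      show "order_exp v - alpha n s (b u) (b v) t
        \<le> order_exp w - alpha n s (b u) (b w) (Suc t)
          + (if b w = b v then 1 else order_exp v - order_exp w)"
        using bds n_le[OF b_in[OF w] b_in[OF v]] n_le[OF b_in[OF v] b_in[OF w]]
        by (cases "b w" "b v" rule: linorder_cases) simp_all
    qed
  qed simp
  moreover have "int p ^ (order_exp v - alpha n s (b u) (b v) t) dvd entry (g \<otimes>\<^bsub>E\<^esub> f) u v"
    if u: "u \<in> U" and v: "v \<in> U" for u v
  proof (rule dvd_entry_mult[OF gE fE u v])
    fix w assume w: "w \<in> U"
    show "int p ^ (order_exp v - alpha n s (b u) (b v) t) dvd entry g u w * entry f w v"
    proof (rule dvd_mult_of_exponents[OF g_dvd[OF u w] lev[OF w v]])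
      note bds = alpha_Suc_bounds[OF n_mono b_in[OF v] b_in[OF u] b_in[OF w], of t]
        alpha_Suc_le(1)[OF n_mono b_in[OF v] b_in[OF u], of t]
      show "order_exp v - alpha n s (b u) (b v) t
        \<le> (if b u = b w then 1 else order_exp w - order_exp u)
          + (order_exp v - alpha n s (b w) (b v) (Suc t))"
        \<comment> \<open>By symmetry, bounds on the second index apply to the first.\<close>
        unfolding alpha_commute[of n s _ "b v"]
        using bds n_le[OF b_in[OF w] b_in[OF u]] n_le[OF b_in[OF u] b_in[OF w]]
        by (cases "b w" "b u" rule: linorder_cases) simp_all
    qed
  qed simp
  ultimately show "f \<otimes>\<^bsub>E\<^esub> g \<in> level t" "g \<otimes>\<^bsub>E\<^esub> f \<in> level t"
    using radical_mult_right[OF f gE] radical_mult_right[OF g fE] by (auto simp: level_def)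
qed

text \<open>Column \<open>v\<close> of \<open>f\<close> reappears in the product as column
  \<open>w\<close>, multiplied by \<open>p ^ j\<close>; cancelling this factor lowers the exponent
  by \<open>j\<close>.\<close>

lemma dvd_of_mult_elementary:
  assumes f: "f \<in> carrier E" "u \<in> U" "v \<in> U" "w \<in> U"
    and "f \<otimes>\<^bsub>E\<^esub> elementary v w (p ^ j) \<in> level t"
  shows "int p ^ (order_exp w - alpha n s (b u) (b w) t - j) dvd entry f u v"
proof -
  let ?k = "order_exp w - alpha n s (b u) (b w) t"
  have "int p ^ ?k dvd int (p ^ j) * entry f u v mod int p ^ order_exp w"
    using assms unfolding entry_mult_elementary[OF f, symmetric] level_def by simp
  then have *: "int p ^ ?k dvd int p ^ j * entry f u v"
    by (simp add: dvd_mod_iff le_imp_power_dvd)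
  show ?thesis using dvd_cancel_power[OF *] .
qed

lemma dvd_of_elementary_mult:
  assumes f: "f \<in> carrier E" "u \<in> U" "v \<in> U" "w \<in> U"
    and "elementary w u (p ^ j) \<otimes>\<^bsub>E\<^esub> f \<in> level t"
  shows "int p ^ (order_exp v - alpha n s (b w) (b v) t - j) dvd entry f u v"
proof -
  let ?k = "order_exp v - alpha n s (b w) (b v) t"
  have "int p ^ ?k dvd of_bool (w = w) * int (p ^ j) * entry f u v mod int p ^ order_exp v"
    using assms unfolding entry_elementary_mult[OF f f(4), symmetric] level_def by simp
  then have *: "int p ^ ?k dvd int p ^ j * entry f u v"
    by (simp add: dvd_mod_iff le_imp_power_dvd)
  show ?thesis using dvd_cancel_power[OF *] .
qed

lemma ex_block: "i \<in> {1..s} \<Longrightarrow> \<exists>w\<in>U. b w = i"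
  unfolding b_image[symmetric] by blast

text \<open>Each of the five terms of the recursion for \<open>\<alpha>\<close> comes from multiplying with one elementary
  endomorphism between neighbouring blocks, with the smallest multiplier that makes it
  well defined and an element of the radical.\<close>

lemma mem_level_Suc:
  assumes f: "f \<in> radical"
    and mult_right: "\<And>g. g \<in> radical \<Longrightarrow> f \<otimes>\<^bsub>E\<^esub> g \<in> level t"
    and mult_left: "\<And>g. g \<in> radical \<Longrightarrow> g \<otimes>\<^bsub>E\<^esub> f \<in> level t"
  shows "f \<in> level (Suc t)"
proof -
  have fE: "f \<in> carrier E" using f by (rule radical_closed)
  have n_le: "n i \<le> n j" if "i \<in> {1..s}" "j \<in> {1..s}" "i \<le> j" for i j
    using strict_mono_on_leD[OF n_mono] that by blast
  have "int p ^ (order_exp v - alpha n s (b u) (b v) (Suc t)) dvd entry f u v"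
    if u: "u \<in> U" and v: "v \<in> U" for u v
    using b_in[OF u] b_in[OF v]
  proof (cases rule: alpha_Suc_cases[where n = n and t = t])
    case same
    have "elementary v v (p ^ 1) \<in> radical"
      using v by (intro elementary_in_radical) auto
    from dvd_of_mult_elementary[OF fE u v v mult_right[OF this]] show ?thesis
      by (simp add: same)
  next
    case left
    then have "b v - 1 \<in> {1..s}" using b_in[OF v] by auto
    then obtain w where w: "w \<in> U" "b w = b v - 1"
      using ex_block by blast
    have le: "order_exp w \<le> order_exp v"
      using n_le[OF b_in[OF w(1)] b_in[OF v]] w(2) by simp
    have "elementary v w (p ^ 0) \<in> radical"
      using v w le left(1) by (intro elementary_in_radical) auto
    \<comment> \<open>Passing from \<open>order_exp w\<close> to \<open>order_exp v\<close> accounts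
      for the gap of \<open>n\<close> in this term.\<close>
    from dvd_of_mult_elementary[OF fE u v w(1) mult_right[OF this]] show ?thesis
      using le by (simp add: left w(2))
  next
    case up
    then have "b u - 1 \<in> {1..s}" using b_in[OF u] by auto
    then obtain w where w: "w \<in> U" "b w = b u - 1"
      using ex_block by blast
    have "elementary w u (p ^ (order_exp u - order_exp w)) \<in> radical"
      using u w up(1) by (intro elementary_in_radical) auto
    from dvd_of_elementary_mult[OF fE u v w(1) mult_left[OF this]] show ?thesis
      by (simp add: up w(2) add.commute)
  next
    case right
    then have "b v + 1 \<in> {1..s}" using b_in[OF v] by auto
    then obtain w where w: "w \<in> U" "b w = b v + 1"
      using ex_block by blast
    have le: "order_exp v \<le> order_exp w"
      using n_le[OF b_in[OF v] b_in[OF w(1)]] w(2) by simp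
    \<comment> \<open>The cost of this multiplier brings \<open>order_exp w\<close> back to exactly
      \<open>order_exp v\<close>, so no gap of \<open>n\<close> occurs in this term.\<close>
    have "elementary v w (p ^ (order_exp w - order_exp v)) \<in> radical"
      using v w by (intro elementary_in_radical) auto
    from dvd_of_mult_elementary[OF fE u v w(1) mult_right[OF this]] show ?thesis
      using le by (simp add: right w(2))
  next
    case down
    then have "b u + 1 \<in> {1..s}" using b_in[OF u] by auto
    then obtain w where w: "w \<in> U" "b w = b u + 1"
      using ex_block by blast
    have le: "order_exp u \<le> order_exp w"
      using n_le[OF b_in[OF u] b_in[OF w(1)]] w(2) by simp
    have "elementary w u (p ^ 0) \<in> radical"
      using u w le by (intro elementary_in_radical) auto
    from dvd_of_elementary_mult[OF fE u v w(1) mult_left[OF this]] show ?thesis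
      by (simp add: down w(2))
  qed
  then show ?thesis using f by (simp add: level_def)
qed

theorem upper_ann_radical: "upper_ann E radical t = level t"
proof (induction t)
  case 0
  show ?case by (simp add: level_0)
next
  case (Suc t)
  show ?case
  proof
    show "upper_ann E radical (Suc t) \<subseteq> level (Suc t)"
      using mem_level_Suc[of _ t] Suc by auto
    show "level (Suc t) \<subseteq> upper_ann E radical (Suc t)"
      using level_mult[of _ t] Suc by (auto simp: level_def[of "Suc t"])
  qed
qed

end

section \<open>Coordinates of a direct sum\<close>

lemma carrier_Zmod_sum:
  "carrier (Zmod_sum m A)
    = {x \<in> \<Pi>\<^sub>E k\<in>A. carrier (integer_mod_group m). finite {k \<in> A. x k \<noteq> 0}}"
  unfolding Zmod_sum_def by (subst carrier_sum_group) auto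

text \<open>As \<open>1 < m\<close>, the number 1 is a valid residue, so unit vectors lie in the
  target and have preimages.\<close>

lemma basis_elem_unit:
  assumes "1 < m" "k \<in> B" and \<phi>: "\<phi> \<in> iso (subgrp G H) (Zmod_sum m B)"
  shows "basis_elem H B \<phi> k \<in> H"
    and "\<phi> (basis_elem H B \<phi> k) = (\<lambda>l\<in>B. if l = k then 1 else 0)"
proof -
  have "{l \<in> B. (\<lambda>l\<in>B. if l = k then 1 else (0::int)) l \<noteq> 0} \<subseteq> {k}" by auto
  then have "(\<lambda>l\<in>B. if l = k then 1 else 0) \<in> carrier (Zmod_sum m B)"
    using assms(1) finite_subset by (fastforce simp: carrier_Zmod_sum carrier_integer_mod_group)
  then have "(\<lambda>l\<in>B. if l = k then 1 else 0) \<in> \<phi> ` H"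
    using \<phi> by (auto simp: iso_def bij_betw_def subgrp_def)
  then show "basis_elem H B \<phi> k \<in> H"
    and "\<phi> (basis_elem H B \<phi> k) = (\<lambda>l\<in>B. if l = k then 1 else 0)"
    unfolding basis_elem_def by (auto intro: inv_into_into f_inv_into_f)
qed

text \<open>Components are the coordinates of the inverse isomorphism \<open>D\<close>, and an
  element of one summand is the product of the family concentrated at that index.\<close>

lemma internal_direct_sum_component:
  assumes "comm_group G" and ds: "internal_direct_sum G I H"
  defines "S \<equiv> sum_group I (\<lambda>i. subgrp G (H i))"
  shows component_hom: "i \<in> I \<Longrightarrow> component G I H i \<in> hom G (subgrp G (H i))"
    and component_same: "i \<in> I \<Longrightarrow> x \<in> H i \<Longrightarrow> component G I H i x = x"
    and component_other: "i \<in> I \<Longrightarrow> j \<in> I \<Longrightarrow> i \<noteq> j \<Longrightarrow> x \<in> H i \<Longrightarrow> component G I H j x = \<one>\<^bsub>G\<^esub>"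
    and component_eq_one: "x \<in> carrier G \<Longrightarrow> (\<And>i. i \<in> I \<Longrightarrow> component G I H i x = \<one>\<^bsub>G\<^esub>) \<Longrightarrow> x = \<one>\<^bsub>G\<^esub>"
proof -
  interpret comm_group G by (rule assms(1))
  have I: "finite I" and sub: "\<And>i. i \<in> I \<Longrightarrow> subgroup (H i) G"
    and iso: "(\<lambda>x. finprod G x I) \<in> iso S G"
    using ds by (auto simp: internal_direct_sum_def S_def)
  have grp: "group (subgrp G (H i))" if "i \<in> I" for i
    using subgroup.subgroup_is_group[OF sub[OF that] is_group] by (simp add: subgrp_def)
  have S: "group S" unfolding S_def using grp by (rule sum_group)
  have carrier_S: "carrier S = (\<Pi>\<^sub>E i\<in>I. H i)"
    unfolding S_def using grp I by (subst carrier_sum_group) (auto simp: subgrp_def)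
  define D where "D = inv_into (carrier S) (\<lambda>x. finprod G x I)"
  have comp: "component G I H i x = D x i" for i x
    by (simp add: component_def D_def S_def)
  have D: "D \<in> iso G S"
    unfolding D_def using group.iso_set_sym[OF S iso] .
  have D_finprod: "D (finprod G y I) = y" if "y \<in> carrier S" for y
    unfolding D_def using iso that by (intro inv_into_f_f) (auto simp: iso_def bij_betw_def)
  have D_in: "D x \<in> (\<Pi>\<^sub>E i\<in>I. H i)" if "x \<in> carrier G" for x
    using D that carrier_S by (auto simp: iso_def hom_def)
  show "component G I H i \<in> hom G (subgrp G (H i))" if i: "i \<in> I" for i
  proof (rule homI)
    show "component G I H i x \<in> carrier (subgrp G (H i))" if "x \<in> carrier G" for x
      using D_in[OF that] i by (auto simp: comp subgrp_def)
    show "component G I H i (x \<otimes>\<^bsub>G\<^esub> y) = component G I H i x \<otimes>\<^bsub>subgrp G (H i)\<^esub> component G I H i y"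
      if "x \<in> carrier G" "y \<in> carrier G" for x y
    proof -
      have "D (x \<otimes>\<^bsub>G\<^esub> y) = D x \<otimes>\<^bsub>S\<^esub> D y"
        using D that by (auto simp: iso_def hom_def)
      then show ?thesis using i by (simp add: comp S_def)
    qed
  qed
  have D_H: "D x = (\<lambda>j\<in>I. if j = i then x else \<one>\<^bsub>G\<^esub>)" (is "_ = ?y") if i: "i \<in> I" and x: "x \<in> H i" for i x
  proof -
    have xG: "x \<in> carrier G" using subgroup.mem_carrier[OF sub[OF i] x] .
    have "?y \<in> carrier S"
      unfolding carrier_S using x subgroup.one_closed[OF sub] by auto
    moreover have "finprod G ?y I = finprod G (\<lambda>j. if i = j then x else \<one>\<^bsub>G\<^esub>) I"
      using xG by (intro finprod_cong') auto
    moreover have "\<dots> = x"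
      using finprod_singleton[OF i I, of "\<lambda>_. x"] xG by simp
    ultimately show ?thesis using D_finprod by metis
  qed
  show "component G I H i x = x" if "i \<in> I" "x \<in> H i" for i x
    using D_H[OF that] that by (simp add: comp)
  show "component G I H j x = \<one>\<^bsub>G\<^esub>" if "i \<in> I" "j \<in> I" "i \<noteq> j" "x \<in> H i" for i j x
    using D_H[OF that(1,4)] that by (simp add: comp)
  show "x = \<one>\<^bsub>G\<^esub>" if x: "x \<in> carrier G" and "\<And>i. i \<in> I \<Longrightarrow> component G I H i x = \<one>\<^bsub>G\<^esub>" for x
  proof -
    have "D x = (\<lambda>i\<in>I. \<one>\<^bsub>G\<^esub>)"
      using PiE_iff[THEN iffD1, OF D_in[OF x]] that(2)
      by (intro extensionalityI[of _ I]) (auto simp: comp)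
    then have "D x = \<one>\<^bsub>S\<^esub>" by (simp add: S_def subgrp_def)
    also have "\<dots> = D \<one>\<^bsub>G\<^esub>"
      using hom_one[OF _ is_group S, of D] D by (simp add: iso_def)
    finally show ?thesis
      using D x by (auto simp: iso_def bij_betw_def inj_on_def)
  qed
qed

text \<open>Pairs of a block and a basis index form the merged index set; a coordinate is the
  projection to a summand followed by its coordinate isomorphism.\<close>

lemma adapted_basis_of_direct_sum:
  fixes G :: "('a, 'b) monoid_scheme"
    and H :: "nat \<Rightarrow> 'a set"
    and B :: "nat \<Rightarrow> 'k set"
    and \<phi> :: "nat \<Rightarrow> 'a \<Rightarrow> 'k \<Rightarrow> int"
    and n :: "nat \<Rightarrow> nat"
    and p s :: nat
  assumes p: "normalization_semidom_class.prime p"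
    and G: "comm_group G"
    and ds: "internal_direct_sum G {1..s} H"
    and n1: "0 < n 1"
    and n: "strict_mono_on {1..s} n"
    and B: "\<And>i. i \<in> {1..s} \<Longrightarrow> B i \<noteq> {}"
    and \<phi>: "\<And>i. i \<in> {1..s} \<Longrightarrow> \<phi> i \<in> iso (subgrp G (H i)) (Zmod_sum (p ^ n i) (B i))"
  shows "adapted_basis G p s n (Sigma {1..s} B) fst
    (\<lambda>(i, k). basis_elem (H i) (B i) (\<phi> i) k) (\<lambda>(j, l) x. \<phi> j (component G {1..s} H j x) l)"
proof -
  interpret comm_group G by (rule G)
  let ?I = "{1..s}"
  have n_pos: "0 < n i" if "i \<in> ?I" for i
    using strict_mono_on_leD[OF n, of 1 i] that n1 by auto
  have sub: "subgroup (H i) G" if "i \<in> ?I" for i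
    using ds that by (auto simp: internal_direct_sum_def)
  have grp: "group (subgrp G (H i))" if "i \<in> ?I" for i
    using subgroup.subgroup_is_group[OF sub[OF that] is_group] by (simp add: subgrp_def)
  have q: "1 < p ^ n i" if "i \<in> ?I" for i
    using n_pos[OF that] prime_gt_1_nat[OF p] by (metis one_less_power)
  have Z: "group (Zmod_sum m A)" for m and A :: "'k set"
    by (simp add: Zmod_sum_def)
  have proj: "(\<lambda>x. x k) \<in> hom (Zmod_sum m A) (integer_mod_group m)" if "k \<in> A" for m k and A :: "'k set"
    using that carrier_Zmod_sum[of m A] by (intro homI) (auto simp: Zmod_sum_def)
  have \<phi>_hom: "\<phi> i \<in> hom (subgrp G (H i)) (Zmod_sum (p ^ n i) (B i))"
    and \<phi>_bij: "bij_betw (\<phi> i) (H i) (carrier (Zmod_sum (p ^ n i) (B i)))" if "i \<in> ?I" for i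
    using \<phi>[OF that] by (auto simp: iso_def subgrp_def)
  have \<phi>_one: "\<phi> i \<one>\<^bsub>G\<^esub> = (\<lambda>k\<in>B i. 0)" if "i \<in> ?I" for i
    using hom_one[OF \<phi>_hom[OF that] grp[OF that] Z] by (simp add: subgrp_def Zmod_sum_def)
  note comp = component_hom[OF G ds] component_same[OF G ds] component_other[OF G ds]
  have comp_H: "component G ?I H i x \<in> H i" if "i \<in> ?I" "x \<in> carrier G" for i x
    using hom_in_carrier[OF comp(1)[OF that(1)] that(2)] by (simp add: subgrp_def)
  have basis_H: "basis_elem (H i) (B i) (\<phi> i) k \<in> H i"
    and \<phi>_basis: "\<phi> i (basis_elem (H i) (B i) (\<phi> i) k) = (\<lambda>l\<in>B i. if l = k then 1 else 0)"
    if "i \<in> ?I" "k \<in> B i" for i k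
    using basis_elem_unit[OF q[OF that(1)] that(2) \<phi>[OF that(1)]] by blast+
  show ?thesis
  proof (unfold_locales, goal_cases)
    case 1
    then show ?case by (rule p)
  next
    case (2 i)
    then show ?case by (rule n_pos)
  next
    case 3
    then show ?case by (rule n)
  next
    case 4
    show ?case
    proof
      show "{1..s} \<subseteq> fst ` Sigma {1..s} B"
      proof
        fix i assume i: "i \<in> {1..s}"
        then obtain k where "k \<in> B i" using B by blast
        then show "i \<in> fst ` Sigma {1..s} B" using i by force
      qed
    qed auto
  next
    case (5 u)
    then show ?case using basis_H sub subgroup.mem_carrier by fastforce
  next
    case (6 u)
    obtain i k where u: "u = (i, k)" and i: "i \<in> ?I" and k: "k \<in> B i" using 6 by auto
    let ?e = "basis_elem (H i) (B i) (\<phi> i) k" and ?q = "p ^ n i" and ?Z = "Zmod_sum (p ^ n i) (B i)"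
    interpret h: group_hom "subgrp G (H i)" ?Z "\<phi> i"
      using grp[OF i] Z \<phi>_hom[OF i] by (simp add: group_hom_def group_hom_axioms_def)
    have pow_eq: "x [^]\<^bsub>subgrp G (H i)\<^esub> m = x [^]\<^bsub>G\<^esub> m" for x and m :: nat
      by (simp add: subgrp_def nat_pow_def)
    have eH: "?e \<in> H i" using basis_H i k by blast
    then have powH: "?e [^]\<^bsub>G\<^esub> ?q \<in> H i"
      using h.G.nat_pow_closed[of ?e ?q] pow_eq by (simp add: subgrp_def)
    \<comment> \<open>That \<open>p ^ n i\<close> kills the basis element is checked in coordinates,
      each of which lies in a cyclic group of that order.\<close>
    have "\<phi> i (?e [^]\<^bsub>G\<^esub> ?q) = \<phi> i ?e [^]\<^bsub>?Z\<^esub> ?q"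
      using h.hom_nat_pow[of ?e ?q] eH pow_eq by (simp add: subgrp_def)
    also have "\<dots> = (\<lambda>l\<in>B i. 0)"
    proof (rule extensionalityI)
      show "\<phi> i ?e [^]\<^bsub>?Z\<^esub> ?q \<in> extensional (B i)"
        using h.H.nat_pow_closed[OF h.hom_closed[of ?e], of ?q] eH carrier_Zmod_sum[of ?q "B i"]
        by (auto simp: subgrp_def PiE_iff)
      fix l assume l: "l \<in> B i"
      have "(\<phi> i ?e [^]\<^bsub>?Z\<^esub> ?q) l = \<phi> i ?e l [^]\<^bsub>integer_mod_group ?q\<^esub> ?q"
        using hom_nat_pow[OF proj[OF l] h.hom_closed[of ?e] Z group_integer_mod_group] eH by (simp add: subgrp_def)
      then show "(\<phi> i ?e [^]\<^bsub>?Z\<^esub> ?q) l = (\<lambda>l\<in>B i. 0) l" using l by simp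
    qed auto
    also have "\<dots> = \<phi> i \<one>\<^bsub>G\<^esub>" by (simp add: \<phi>_one[OF i])
    finally have "?e [^]\<^bsub>G\<^esub> ?q = \<one>\<^bsub>G\<^esub>"
      using \<phi>_bij[OF i] powH subgroup.one_closed[OF sub[OF i]] by (auto simp: bij_betw_def inj_on_def)
    then show ?case by (simp add: u)
  next
    case (7 u)
    then obtain i k where u: "u = (i, k)" and i: "i \<in> ?I" and k: "k \<in> B i" by auto
    have "(\<lambda>x. x k) \<circ> (\<phi> i \<circ> component G ?I H i) \<in> hom G (integer_mod_group (p ^ n i))"
      by (rule Group.hom_compose[OF Group.hom_compose[OF comp(1)[OF i] \<phi>_hom[OF i]] proj[OF k]])
    then show ?case by (simp add: u comp_def)
  next
    case (8 u v)
    obtain i k where u: "u = (i, k)" and i: "i \<in> ?I" and k: "k \<in> B i" using 8 by auto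
    obtain j l where v: "v = (j, l)" and j: "j \<in> ?I" and l: "l \<in> B j" using 8 by auto
    show ?case
      using comp(2)[OF i basis_H[OF i k]] comp(3)[OF i j _ basis_H[OF i k]] \<phi>_basis[OF i k] \<phi>_one[OF j] l
      by (cases "i = j") (auto simp: u v)
  next
    case (9 x)
    have "{u \<in> Sigma ?I B. (case u of (j, l) \<Rightarrow> \<lambda>x. \<phi> j (component G ?I H j x) l) x \<noteq> 0}
      = Sigma ?I (\<lambda>j. {l \<in> B j. \<phi> j (component G ?I H j x) l \<noteq> 0})"
      by auto
    \<comment> \<open>The \<open>B j\<close> may be infinite, but elements of the direct sum have
      finite support.\<close>
    moreover have "finite {l \<in> B j. \<phi> j (component G ?I H j x) l \<noteq> 0}" if "j \<in> ?I" for j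
      using bij_betwE[OF \<phi>_bij[OF that]] comp_H[OF that 9] carrier_Zmod_sum[of "p ^ n j" "B j"] by blast
    ultimately show ?case by (auto intro!: finite_SigmaI)
  next
    case (10 x)
    show ?case
    proof (rule component_eq_one[OF G ds 10(1)])
      fix i assume i: "i \<in> ?I"
      have "\<phi> i (component G ?I H i x) \<in> extensional (B i)"
        using bij_betwE[OF \<phi>_bij[OF i]] comp_H[OF i 10(1)] carrier_Zmod_sum[of "p ^ n i" "B i"]
        by (auto simp: PiE_iff)
      then have "\<phi> i (component G ?I H i x) = (\<lambda>k\<in>B i. 0)"
        using 10(2)[of "(i, _)"] i by (intro extensionalityI[of _ "B i"]) auto
      then have "\<phi> i (component G ?I H i x) = \<phi> i \<one>\<^bsub>G\<^esub>" by (simp add: \<phi>_one[OF i])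
      then show "component G ?I H i x = \<one>\<^bsub>G\<^esub>"
        using \<phi>_bij[OF i] comp_H[OF i 10(1)] subgroup.one_closed[OF sub[OF i]]
        by (auto simp: bij_betw_def inj_on_def)
    qed
  qed
qed

theorem corollary4p3:
  fixes G :: "('a, 'b) monoid_scheme"
    and H :: "nat \<Rightarrow> 'a set"
    and B :: "nat \<Rightarrow> 'k set"
    and \<phi> :: "nat \<Rightarrow> 'a \<Rightarrow> 'k \<Rightarrow> int"
    and n :: "nat \<Rightarrow> nat"
    and p s t :: nat
  defines "J \<equiv> jacobson_radical (End_ring G)"
  assumes "normalization_semidom_class.prime p"
    and "comm_group G"
    and "1 \<le> s"
    and "internal_direct_sum G {1..s} H"
    and "0 < n 1"
    and "strict_mono_on {1..s} n"
    and "\<And>i. i \<in> {1..s} \<Longrightarrow> B i \<noteq> {}"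
    and "\<And>i. i \<in> {1..s} \<Longrightarrow> \<phi> i \<in> iso (subgrp G (H i)) (Zmod_sum (p ^ n i) (B i))"
    and "1 \<le> t"
    and "t \<le> ann_length (End_ring G) J"
  shows "upper_ann (End_ring G) J t =
    {f \<in> J. \<forall>i\<in>{1..s}. \<forall>j\<in>{1..s}. \<forall>k\<in>B i. \<forall>l\<in>B j.
       int (p ^ (n j - alpha n s i j t)) dvd
         mat_entry (H i) (B i) (\<phi> i) (\<phi> j) (block G {1..s} H f i j) k l}"
proof -
  interpret basis: adapted_basis G p s n "Sigma {1..s} B" fst
    "\<lambda>(i, k). basis_elem (H i) (B i) (\<phi> i) k" "\<lambda>(j, l) x. \<phi> j (component G {1..s} H j x) l"
    using assms by (intro adapted_basis_of_direct_sum)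
  \<comment> \<open>\<open>block\<close> is specified only on \<open>H i\<close>, so the equality
    with an entry of \<open>f\<close> rests on the basis element lying in
    \<open>H i\<close>.\<close>
  have "mat_entry (H i) (B i) (\<phi> i) (\<phi> j) (block G {1..s} H f i j) k l = basis.entry f (i, k) (j, l)"
    if "i \<in> {1..s}" "k \<in> B i" for f i j k l
  proof -
    have "1 < p ^ n i"
      using basis.p_gt_1 basis.n_pos[OF that(1)] by (metis one_less_power of_nat_1 of_nat_less_iff)
    then have "basis_elem (H i) (B i) (\<phi> i) k \<in> H i"
      using that(2) assms(9)[OF that(1)] by (rule basis_elem_unit)
    then show ?thesis
      unfolding mat_entry_def block_def basis.entry_def by simp
  qed
  then show ?thesis
    unfolding J_def basis.jacobson_radical_eq basis.upper_ann_radical basis.level_def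
    by (auto simp del: One_nat_def)
qed

end
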